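(* Let $n\ge 5$ and let $P_n$ be the path on $n$ vertices. If $n$ is even then $\mathrm{ern}(P_n)=2$, while if $n$ is odd then $\mathrm{ern}(P_n)=3$.
   Context: All graphs are finite, simple and undirected. An edge-card of a graph $G$ is an edge-deleted subgraph $G-e$ (all vertices are kept), considered up to isomorphism. For distinct edges $e_1,\dots,e_k$ of $G$, the edge-cards $G-e_1,\dots,G-e_k$ are said to reconstruct $G$ if every graph $H$ having distinct edges $f_1,\dots,f_k$ with $H-f_i\simeq G-e_i$ for all $i$ is isomorphic to $G$ ($H$ ranges over all graphs, not only trees). The edge-reconstruction number $\mathrm{ern}(G)$ is the least $k$ for which some $k$ edge-cards of $G$ reconstruct $G$. *)

theory Defs
  imports Main "HOL-Library.Extended_Nat"
begin

type_synonym 'a graph = "'a set \<times> 'a set set"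

abbreviation verts :: "'a graph \<Rightarrow> 'a set" where "verts \<equiv> fst"
abbreviation edges :: "'a graph \<Rightarrow> 'a set set" where "edges \<equiv> snd"

definition simple_graph :: "'a graph \<Rightarrow> bool" where
  "simple_graph G \<longleftrightarrow> finite (verts G) \<and> (\<forall>e\<in>edges G. e \<subseteq> verts G \<and> card e = 2)"

definition isomorphic :: "'a graph \<Rightarrow> 'b graph \<Rightarrow> bool"  (infix \<open>\<simeq>\<close> 50) where
  "G \<simeq> H \<longleftrightarrow> (\<exists>\<phi>. bij_betw \<phi> (verts G) (verts H) \<and>
     (\<forall>u\<in>verts G. \<forall>v\<in>verts G. {u, v} \<in> edges G \<longleftrightarrow> {\<phi> u, \<phi> v} \<in> edges H))"

definition delete_edge :: "'a graph \<Rightarrow> 'a set \<Rightarrow> 'a graph" where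
  "delete_edge G e = (verts G, edges G - {e})"

text \<open>
  The distinct edges \<open>e\<^sub>1, \<dots>, e\<^sub>k\<close> of \<open>G\<close> form the set \<open>S\<close>; the injection \<open>f\<close> sends each \<open>e\<^sub>i\<close>
  to \<open>f\<^sub>i\<close>. Letting \<open>H\<close> range over graphs on natural numbers loses nothing, since every finite
  graph is isomorphic to one of these (see \<open>reconstructs_any_type\<close> below).
\<close>

definition reconstructs :: "'a graph \<Rightarrow> 'a set set \<Rightarrow> bool" where
  "reconstructs G S \<longleftrightarrow> (\<forall>H :: nat graph. simple_graph H \<longrightarrow>
     (\<exists>f. inj_on f S \<and> f ` S \<subseteq> edges H \<and> (\<forall>e\<in>S. delete_edge H (f e) \<simeq> delete_edge G e)) \<longrightarrow>
     H \<simeq> G)"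

text \<open>The value is \<open>\<infinity>\<close> if no set of edge-cards reconstructs \<open>G\<close>.\<close>

definition ern :: "'a graph \<Rightarrow> enat" where
  "ern G = (INF S \<in> {S. S \<subseteq> edges G \<and> finite S \<and> reconstructs G S}. enat (card S))"

definition path_graph :: "nat \<Rightarrow> nat graph" where
  "path_graph n = ({..<n}, {{i, Suc i} | i. Suc i < n})"

lemma simple_graph_path_graph: "simple_graph (path_graph n)"
  by (auto simp: simple_graph_def path_graph_def)

lemma Inf_eq_enat_iff: "Inf C = enat k \<longleftrightarrow> enat k \<in> C \<and> (\<forall>x\<in>C. enat k \<le> x)"
proof
  assume L: "Inf C = enat k"
  have "C \<noteq> {}"
    using L by (intro notI) (simp add: Inf_enat_def)
  then obtain c where "c \<in> C" by blast
  then have "(LEAST x. x \<in> C) \<in> C" by (rule LeastI)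
  then have "Inf C \<in> C" using \<open>C \<noteq> {}\<close> by (simp add: Inf_enat_def)
  then show "enat k \<in> C \<and> (\<forall>x\<in>C. enat k \<le> x)"
    unfolding L[symmetric] by (simp add: Inf_lower)
next
  assume "enat k \<in> C \<and> (\<forall>x\<in>C. enat k \<le> x)"
  then show "Inf C = enat k" by (intro antisym Inf_lower Inf_greatest) auto
qed

lemma ern_eq_enat_iff:
  "ern G = enat k \<longleftrightarrow>
     (\<exists>S. S \<subseteq> edges G \<and> finite S \<and> card S = k \<and> reconstructs G S) \<and>
     (\<forall>S. S \<subseteq> edges G \<and> finite S \<and> reconstructs G S \<longrightarrow> k \<le> card S)"
  unfolding ern_def Inf_eq_enat_iff by (auto simp: image_iff)

lemma isomorphic_sym: "G \<simeq> H \<Longrightarrow> H \<simeq> G"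
proof -
  assume "G \<simeq> H"
  then obtain p where p: "bij_betw p (verts G) (verts H)"
    and e: "\<And>u v. u \<in> verts G \<Longrightarrow> v \<in> verts G \<Longrightarrow> {u, v} \<in> edges G \<longleftrightarrow> {p u, p v} \<in> edges H"
    by (auto simp: isomorphic_def)
  let ?q = "inv_into (verts G) p"
  have q: "bij_betw ?q (verts H) (verts G)" using p by (rule bij_betw_inv_into)
  have "{u, v} \<in> edges H \<longleftrightarrow> {?q u, ?q v} \<in> edges G" if "u \<in> verts H" "v \<in> verts H" for u v
    using e[of "?q u" "?q v"] that bij_betw_inv_into_right[OF p] bij_betwE[OF q] by simp
  then show "H \<simeq> G" using q unfolding isomorphic_def by blast
qed

lemma isomorphic_trans: "G \<simeq> H \<Longrightarrow> H \<simeq> K \<Longrightarrow> G \<simeq> K"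
proof -
  assume "G \<simeq> H" "H \<simeq> K"
  then obtain p q where p: "bij_betw p (verts G) (verts H)" and q: "bij_betw q (verts H) (verts K)"
    and e: "\<forall>u\<in>verts G. \<forall>v\<in>verts G. {u, v} \<in> edges G \<longleftrightarrow> {p u, p v} \<in> edges H"
    and f: "\<forall>u\<in>verts H. \<forall>v\<in>verts H. {u, v} \<in> edges H \<longleftrightarrow> {q u, q v} \<in> edges K"
    by (auto simp: isomorphic_def)
  have "\<forall>u\<in>verts G. \<forall>v\<in>verts G. {u, v} \<in> edges G \<longleftrightarrow> {(q \<circ> p) u, (q \<circ> p) v} \<in> edges K"
    using e f bij_betwE[OF p] by simp
  then show "G \<simeq> K" using bij_betw_trans[OF p q] unfolding isomorphic_def by blast
qed

lemma reconstructs_any_type: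
  fixes G :: "'a graph" and H :: "'b graph"
  assumes R: "reconstructs G S" and H: "simple_graph H"
    and f: "inj_on f S" "f ` S \<subseteq> edges H" "\<And>e. e \<in> S \<Longrightarrow> delete_edge H (f e) \<simeq> delete_edge G e"
  shows "H \<simeq> G"
proof -
  have fin: "finite (verts H)" and E: "\<And>e. e \<in> edges H \<Longrightarrow> e \<subseteq> verts H \<and> card e = 2"
    using H by (auto simp: simple_graph_def)
  obtain p :: "'b \<Rightarrow> nat" where p: "inj_on p (verts H)"
    using finite_imp_inj_to_nat_seg[OF fin] by blast
  define H' where "H' = (p ` verts H, (`) p ` edges H)"
  have inj: "inj_on ((`) p) (Pow (verts H))" using p by (rule inj_on_image_Pow)
  have mem: "p ` d \<in> (`) p ` D \<longleftrightarrow> d \<in> D" if "d \<subseteq> verts H" "D \<subseteq> Pow (verts H)" for d D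
    using inj_on_image_mem_iff[OF inj, of d D] that by simp
  have edges_Pow: "edges H \<subseteq> Pow (verts H)" using E by blast
  have del: "delete_edge H d \<simeq> delete_edge H' (p ` d)" if d: "d \<in> edges H" for d
  proof -
    have "{u, v} \<in> edges H - {d} \<longleftrightarrow> {p u, p v} \<in> (`) p ` edges H - {p ` d}"
      if "u \<in> verts H" "v \<in> verts H" for u v
      using mem[of "{u, v}" "edges H"] mem[of "{u, v}" "{d}"] that edges_Pow E[OF d] by simp
    then show ?thesis using inj_on_imp_bij_betw[OF p]
      unfolding isomorphic_def delete_edge_def H'_def by (intro exI[of _ p]) simp
  qed
  have iso: "H \<simeq> H'"
  proof -
    have "{u, v} \<in> edges H \<longleftrightarrow> {p u, p v} \<in> (`) p ` edges H"
      if "u \<in> verts H" "v \<in> verts H" for u v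
      using mem[of "{u, v}" "edges H"] that edges_Pow by simp
    then show ?thesis using inj_on_imp_bij_betw[OF p]
      unfolding isomorphic_def H'_def by (intro exI[of _ p]) simp
  qed
  have "simple_graph H'"
    unfolding simple_graph_def H'_def using fin E
    by (auto simp: card_image[OF inj_on_subset[OF p]])
  moreover have "inj_on (\<lambda>e. p ` f e) S"
    using comp_inj_on[OF f(1) inj_on_subset[OF inj]] f(2) edges_Pow by (auto simp: comp_def)
  moreover have "(\<lambda>e. p ` f e) ` S \<subseteq> edges H'" using f(2) by (auto simp: H'_def)
  moreover have "\<forall>e\<in>S. delete_edge H' (p ` f e) \<simeq> delete_edge G e"
  proof
    fix e assume e: "e \<in> S"
    then have "f e \<in> edges H" using f(2) by blast
    then show "delete_edge H' (p ` f e) \<simeq> delete_edge G e"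
      by (rule isomorphic_trans[OF isomorphic_sym[OF del] f(3)[OF e]])
  qed
  ultimately have "H' \<simeq> G"
    using R[unfolded reconstructs_def, rule_format, of H', OF _ exI[of _ "\<lambda>e. p ` f e"]] by simp
  then show ?thesis by (rule isomorphic_trans[OF iso])
qed

end

theory Submission
  imports Defs
begin

text \<open>
  Deleting an edge of \<open>P\<^sub>n\<close> leaves \<open>P\<^sub>a \<union> P\<^sub>n\<^sub>-\<^sub>a\<close>, so a graph \<open>H\<close> sharing this card is
  \<open>P\<^sub>a \<union> P\<^sub>n\<^sub>-\<^sub>a\<close> plus an edge.

  Upper bounds: take \<open>a = n div 2\<close>. If the new edge lies inside one of the two paths, every card of
  \<open>H\<close> that has two components has components of orders \<open>a\<close> and \<open>n - a\<close>; a card of \<open>P\<^sub>n\<close> with other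
  orders excludes this. If the new edge joins the two paths and \<open>H\<close> is not a path, then one of its
  ends has degree 3, so any other deleted edge giving a linear forest is incident with that end and
  cuts off a path on at most \<open>n - a - 2\<close> vertices; a second nearly balanced card excludes this.

  Lower bounds: \<open>P\<^sub>a \<union> C\<^sub>n\<^sub>-\<^sub>a\<close> has the card \<open>P\<^sub>a \<union> P\<^sub>n\<^sub>-\<^sub>a\<close> several times, and the
  spider with legs of lengths \<open>a\<close>, \<open>c\<close> and \<open>n - 1 - a - c\<close> has the cards
  \<open>P\<^sub>a \<union> P\<^sub>n\<^sub>-\<^sub>a\<close> and \<open>P\<^sub>c \<union> P\<^sub>n\<^sub>-\<^sub>c\<close>. For odd \<open>n\<close> and
  distinct \<open>a, c < n / 2\<close> the third leg is nonempty, so no two cards suffice.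
\<close>

text \<open>The case \<open>a = 0\<close> is the path itself.\<close>

definition split_path :: "nat \<Rightarrow> nat \<Rightarrow> nat graph" where
  "split_path n a = ({..<n}, {{i, Suc i} | i. Suc i < n \<and> Suc i \<noteq> a})"

text \<open>Indexed by the order of the left-hand path that remains after deleting this edge, so the
  indices run from 1 to \<open>n - 1\<close>.\<close>

definition path_edge :: "nat \<Rightarrow> nat set" where
  "path_edge a = {a - 1, a}"

definition insert_edge :: "'a set \<Rightarrow> 'a graph \<Rightarrow> 'a graph" where
  "insert_edge e G = (verts G, insert e (edges G))"

text \<open>Sets that no edge leaves stand in for connected components, so component orders can be
  compared without walks or connectivity.\<close>

definition union_of_components :: "'a graph \<Rightarrow> 'a set \<Rightarrow> bool" where
  "union_of_components G X \<longleftrightarrow> X \<subseteq> verts G \<and>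
     (\<forall>u\<in>verts G. \<forall>v\<in>verts G. {u, v} \<in> edges G \<longrightarrow> (u \<in> X \<longleftrightarrow> v \<in> X))"

section \<open>Edges of paths and isomorphisms between explicit graphs\<close>

lemma verts_simps [simp]:
  "verts (path_graph n) = {..<n}" "verts (split_path n a) = {..<n}"
  "verts (insert_edge e G) = verts G" "verts (delete_edge G e) = verts G"
  by (simp_all add: path_graph_def split_path_def insert_edge_def delete_edge_def)

lemma edges_simps [simp]:
  "edges (insert_edge e G) = insert e (edges G)" "edges (delete_edge G e) = edges G - {e}"
  by (simp_all add: insert_edge_def delete_edge_def)

lemma mem_edges_split_path [simp]:
  "{i, j} \<in> edges (split_path n a) \<longleftrightarrow>
     i < n \<and> j < n \<and> (j = Suc i \<and> j \<noteq> a \<or> i = Suc j \<and> i \<noteq> a)"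
  by (auto simp: split_path_def doubleton_eq_iff)

lemma singleton_notin_edges_split_path [simp]: "{i} \<notin> edges (split_path n a)"
  using mem_edges_split_path[of i i n a] by simp

lemma path_graph_eq_split_path: "path_graph n = split_path n 0"
  by (simp add: path_graph_def split_path_def)

lemma edges_path_graph: "edges (path_graph n) = path_edge ` {0<..<n}"
proof -
  have "{i, Suc i} \<in> path_edge ` {0<..<n}" if "Suc i < n" for i
    using that by (intro image_eqI[of _ _ "Suc i"]) (auto simp: path_edge_def)
  moreover have "\<exists>i. path_edge a = {i, Suc i} \<and> Suc i < n" if "0 < a" "a < n" for a
    using that by (intro exI[of _ "a - 1"]) (simp add: path_edge_def)
  ultimately show ?thesis by (fastforce simp: path_graph_def)
qed

lemma path_edge_eq_iff: "0 < a \<Longrightarrow> 0 < b \<Longrightarrow> path_edge a = path_edge b \<longleftrightarrow> a = b"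
  by (auto simp: path_edge_def doubleton_eq_iff)

lemma delete_edge_path_graph:
  assumes "0 < a"
  shows "delete_edge (path_graph n) (path_edge a) = split_path n a"
proof -
  have "{i, Suc i} = path_edge a \<longleftrightarrow> Suc i = a" for i
    using assms by (auto simp: path_edge_def doubleton_eq_iff)
  then show ?thesis by (auto simp: delete_edge_def path_graph_def split_path_def)
qed

lemma simple_graph_insert_split_path:
  "u < n \<Longrightarrow> v < n \<Longrightarrow> u \<noteq> v \<Longrightarrow> simple_graph (insert_edge {u, v} (split_path n a))"
  by (auto simp: simple_graph_def insert_edge_def split_path_def)

text \<open>An injective self-map of a finite set is bijective, and adjacency is symmetric, so
  ordered pairs \<open>i \<le> j\<close> suffice.\<close>

lemma isomorphic_lessThanI:
  fixes G H :: "nat graph"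
  assumes V: "verts G = {..<n}" "verts H = {..<n}"
    and inj: "\<And>i j. i < n \<Longrightarrow> j < n \<Longrightarrow> p i = p j \<Longrightarrow> i = j" and lt: "\<And>i. i < n \<Longrightarrow> p i < n"
    and adj: "\<And>i j. i \<le> j \<Longrightarrow> j < n \<Longrightarrow> {i, j} \<in> edges G \<longleftrightarrow> {p i, p j} \<in> edges H"
  shows "G \<simeq> H"
proof -
  have "{i, j} \<in> edges G \<longleftrightarrow> {p i, p j} \<in> edges H" if "i < n" "j < n" for i j
    using adj[of i j] adj[of j i] that by (cases "i \<le> j") (simp_all add: insert_commute)
  moreover have "inj_on p {..<n}" using inj by (auto simp: inj_on_def)
  moreover from this have "p ` {..<n} = {..<n}"
    using endo_inj_surj[of "{..<n}" p] lt by (simp add: image_subset_iff)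
  ultimately show ?thesis
    unfolding isomorphic_def bij_betw_def V by (intro exI[of _ p]) simp
qed

lemma isomorphic_refl: "G \<simeq> G"
  unfolding isomorphic_def by (intro exI[of _ id]) simp

lemma split_path_reflect:
  assumes "0 < a" "a < n"
  shows "split_path n a \<simeq> split_path n (n - a)"
  by (rule isomorphic_lessThanI[where n = n and p = "\<lambda>i. n - 1 - i"])
    (use assms in \<open>simp_all, arith+\<close>)

section \<open>Invariants of cards: component orders and degrees\<close>

lemma union_of_components_isomorphic:
  assumes "G \<simeq> H" "union_of_components G X"
  obtains Y where "union_of_components H Y" "card Y = card X"
proof -
  obtain p where p: "bij_betw p (verts G) (verts H)"
    and e: "\<And>u v. u \<in> verts G \<Longrightarrow> v \<in> verts G \<Longrightarrow> {u, v} \<in> edges G \<longleftrightarrow> {p u, p v} \<in> edges H"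
    using assms(1) by (auto simp: isomorphic_def)
  have X: "X \<subseteq> verts G"
    and cl: "\<And>u v. u \<in> verts G \<Longrightarrow> v \<in> verts G \<Longrightarrow> {u, v} \<in> edges G \<Longrightarrow> u \<in> X \<longleftrightarrow> v \<in> X"
    using assms(2) by (auto simp: union_of_components_def)
  have inj: "inj_on p (verts G)" and im: "verts H = p ` verts G"
    using p by (auto simp: bij_betw_def)
  have "union_of_components H (p ` X)"
    unfolding union_of_components_def im
    using X cl e by (auto simp: inj_on_image_mem_iff[OF inj])
  moreover have "card (p ` X) = card X" by (rule card_image[OF inj_on_subset[OF inj X]])
  ultimately show ?thesis by (rule that)
qed

text \<open>Membership in \<open>X\<close> is constant along each of the two paths. For
  \<open>c = 0\<close> this says that the path is connected.\<close>

lemma card_union_of_components_split_path: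
  assumes "union_of_components (split_path n c) X" "c \<le> n"
  shows "card X \<in> {0, c, n - c, n}"
proof -
  have X: "X \<subseteq> {..<n}"
    and step: "\<And>i. Suc i < n \<Longrightarrow> Suc i \<noteq> c \<Longrightarrow> i \<in> X \<longleftrightarrow> Suc i \<in> X"
    using assms(1) unfolding union_of_components_def
    by (simp, metis Suc_lessD mem_edges_split_path verts_simps(2) lessThan_iff)
  have left: "i \<in> X \<longleftrightarrow> 0 \<in> X" if "i < c" for i
    using that assms(2) by (induction i) (simp_all add: step[symmetric])
  have right: "c + i \<in> X \<longleftrightarrow> c \<in> X" if "c + i < n" for i
    using that by (induction i) (simp_all add: step[symmetric])
  have right': "i \<in> X \<longleftrightarrow> c \<in> X" if "c \<le> i" "i < n" for i
    using right[of "i - c"] that by simp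
  have "i \<in> X \<longleftrightarrow> (if i < c then 0 \<in> X else i < n \<and> c \<in> X)" for i
    using left[of i] right'[of i] X by (meson lessThan_iff not_less subsetD)
  \<comment> \<open>Replacing the two truth values by variables removes \<open>X\<close> from the
    right-hand side.\<close>
  then obtain P Q where "\<And>i. i \<in> X \<longleftrightarrow> (if i < c then P else i < n \<and> Q)"
    by (rule that)
  then have "X = (if P then {..<c} else {}) \<union> (if Q then {c..<n} else {})"
    using assms(2) by (intro set_eqI) (auto split: if_splits)
  moreover have "{..<c} \<union> {c..<n} = {..<n}" using assms(2) by auto
  ultimately show ?thesis by (auto split: if_splits)
qed

lemma card_union_of_components_isomorphic:
  assumes "G \<simeq> split_path n c" "union_of_components G X" "c \<le> n"
  shows "card X \<in> {0, c, n - c, n}"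
  using union_of_components_isomorphic[OF assms(1,2)] card_union_of_components_split_path assms(3)
  by metis

text \<open>In \<open>split_path\<close> the neighbours of \<open>i\<close> are among
  \<open>i - 1\<close> and \<open>i + 1\<close>.\<close>

lemma split_path_degree_le_2:
  assumes iso: "G \<simeq> split_path n c"
    and V: "x \<in> verts G" "y \<in> verts G" "z \<in> verts G" "w \<in> verts G"
    and E: "{x, y} \<in> edges G" "{x, z} \<in> edges G" "{x, w} \<in> edges G"
  shows "y = z \<or> y = w \<or> z = w"
proof -
  obtain p where p: "bij_betw p (verts G) {..<n}"
    and e: "\<And>u v. u \<in> verts G \<Longrightarrow> v \<in> verts G \<Longrightarrow>
      {u, v} \<in> edges G \<longleftrightarrow> {p u, p v} \<in> edges (split_path n c)"
    using iso by (auto simp: isomorphic_def)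
  have "p y = p z \<or> p y = p w \<or> p z = p w"
    using E V by (auto simp: e)
  then show ?thesis
    using V bij_betw_imp_inj_on[OF p] by (auto simp: inj_on_def)
qed

section \<open>Upper bounds: locating the added edge\<close>

text \<open>No edge leaves \<open>{..<a}\<close> when the added edge stays on one side, and
  \<open>a\<close> is neither 0 nor \<open>n\<close>.\<close>

lemma not_connecting_card:
  assumes iso: "delete_edge (insert_edge {u, v} (split_path n a)) e \<simeq> split_path n c"
    and "0 < a" "a < n" "0 < c" "c < n" and side: "u < a \<longleftrightarrow> v < a"
  shows "c = a \<or> c = n - a"
proof -
  have "union_of_components (delete_edge (insert_edge {u, v} (split_path n a)) e) {..<a}"
    using assms(2,3) side by (auto simp: union_of_components_def doubleton_eq_iff)
  then show ?thesis
    using card_union_of_components_isomorphic[OF iso] assms(2-5) by fastforce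
qed

text \<open>If an end of the added edge is interior to its path, \<open>e\<close> must be incident
  with it. The piece cut off then misses that end and at least one vertex beyond it, hence the
  \<open>+ 2\<close>. If both ends are end vertices of their paths, the result is a path.\<close>

lemma connecting_card:
  fixes u v :: nat
  assumes iso: "delete_edge (insert_edge {u, v} (split_path n a)) e \<simeq> split_path n c"
    and e: "e \<in> edges (split_path n a)"
    and n: "0 < a" "a < n" "0 < c" "c < n" and uv: "u < a" "a \<le> v" "v < n"
  shows "insert_edge {u, v} (split_path n a) \<simeq> path_graph n \<or>
    min c (n - c) + 2 \<le> max a (n - a)"
proof -
  let ?H = "insert_edge {u, v} (split_path n a)"
  obtain j where j: "e = {j, Suc j}" "Suc j < n" "Suc j \<noteq> a"
    using e by (auto simp: split_path_def)
  have e_iff: "{x, y} = e \<longleftrightarrow> x = j \<and> y = Suc j \<or> x = Suc j \<and> y = j" for x y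
    unfolding j by (auto simp: doubleton_eq_iff)
  have small: "min c (n - c) + 2 \<le> max a (n - a)"
    if "union_of_components (delete_edge ?H e) X" "0 < card X" "card X + 2 \<le> max a (n - a)" for X
    using card_union_of_components_isomorphic[OF iso that(1)] that(2,3) n by auto
  note degree = split_path_degree_le_2[OF iso]
  consider "0 < u" "Suc u < a" | "a < v" "Suc v < n" | "u = 0 \<or> Suc u = a" "v = a \<or> Suc v = n"
    using uv by linarith
  then show ?thesis
  proof cases
    case 1
    \<comment> \<open>Otherwise \<open>u\<close> would keep the three neighbours
      \<open>u - 1\<close>, \<open>Suc u\<close> and \<open>v\<close>.\<close>
    have "j = u - 1 \<or> j = u"
      using degree[of u "u - 1" "Suc u" v] 1 uv n by (simp add: e_iff; arith)
    then show ?thesis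
    proof
      assume "j = u - 1"
      then have "union_of_components (delete_edge ?H e) {..<u}"
        using 1 uv n by (auto simp: union_of_components_def e_iff doubleton_eq_iff)
      from small[OF this] show ?thesis using 1 by simp
    next
      assume "j = u"
      then have "union_of_components (delete_edge ?H e) {Suc u..<a}"
        using 1 uv n by (auto simp: union_of_components_def e_iff doubleton_eq_iff)
      from small[OF this] show ?thesis using 1 by simp
    qed
  next
    case 2
    have "j = v - 1 \<or> j = v"
      using degree[of v "v - 1" "Suc v" u] 2 uv n by (simp add: e_iff doubleton_eq_iff; arith)
    then show ?thesis
    proof
      assume "j = v - 1"
      then have "union_of_components (delete_edge ?H e) {a..<v}"
        using 2 uv n by (auto simp: union_of_components_def e_iff doubleton_eq_iff)
      from small[OF this] show ?thesis using 2 by simp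
    next
      assume "j = v"
      then have "union_of_components (delete_edge ?H e) {Suc v..<n}"
        using 2 uv n by (auto simp: union_of_components_def e_iff doubleton_eq_iff)
      from small[OF this] show ?thesis using 2 by simp
    qed
  next
    case 3
    \<comment> \<open>Each path is reversed if necessary, so that \<open>u\<close> goes to
      \<open>a - 1\<close> and \<open>v\<close> to \<open>a\<close>.\<close>
    define p where "p i = (if i < a then if Suc u = a then i else a - 1 - i
      else if v = a then i else n - 1 + a - i)" for i
    have "?H \<simeq> split_path n 0"
    proof (rule isomorphic_lessThanI[where n = n and p = p])
      show "i = j" if "i < n" "j < n" "p i = p j" for i j
        using that n unfolding p_def by (auto split: if_splits)
      show "p i < n" if "i < n" for i
        using that n unfolding p_def by auto
      have "{i, j} \<in> edges ?H \<longleftrightarrow> p j = Suc (p i) \<or> p i = Suc (p j)" if "i \<le> j" "j < n" for i j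
        using 3 uv n that unfolding p_def by (auto simp: doubleton_eq_iff split: if_splits)
      then show "{i, j} \<in> edges ?H \<longleftrightarrow> {p i, p j} \<in> edges (split_path n 0)"
        if "i \<le> j" "j < n" for i j
        using that n unfolding p_def by auto
    qed simp_all
    then show ?thesis by (simp add: path_graph_eq_split_path)
  qed
qed

text \<open>The isomorphism of one card also maps \<open>H\<close> onto \<open>K\<close> plus an
  edge, which turns the other cards of \<open>H\<close> into deletions of edges of the concrete
  graph \<open>K\<close>.\<close>

lemma transport_insert_edge:
  assumes H: "simple_graph H" and d: "d \<in> edges H" and iso: "delete_edge H d \<simeq> K"
  obtains u v where "u \<in> verts K" "v \<in> verts K" "u \<noteq> v" "H \<simeq> insert_edge {u, v} K"
    "\<And>e. e \<in> edges H \<Longrightarrow> e \<noteq> d \<Longrightarrow>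
      \<exists>e'\<in>edges K. delete_edge H e \<simeq> delete_edge (insert_edge {u, v} K) e'"
proof -
  obtain p where p: "bij_betw p (verts H) (verts K)"
    and adj: "\<And>u v. u \<in> verts H \<Longrightarrow> v \<in> verts H \<Longrightarrow>
      {u, v} \<in> edges H - {d} \<longleftrightarrow> {p u, p v} \<in> edges K"
    using iso by (auto simp: isomorphic_def)
  have inj: "inj_on p (verts H)" and im: "p ` verts H = verts K"
    using p by (auto simp: bij_betw_def)
  have ends: "\<exists>x y. e = {x, y} \<and> x \<in> verts H \<and> y \<in> verts H \<and> x \<noteq> y" if "e \<in> edges H" for e
  proof -
    have "e \<subseteq> verts H" "card e = 2" using that H by (auto simp: simple_graph_def)
    then show ?thesis by (auto simp: card_2_iff)
  qed
  obtain x y where xy: "d = {x, y}" "x \<in> verts H" "y \<in> verts H" "x \<noteq> y"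
    using ends[OF d] by blast
  have pair: "{p u, p v} = {p r, p s} \<longleftrightarrow> {u, v} = {r, s}"
    if "u \<in> verts H" "v \<in> verts H" "r \<in> verts H" "s \<in> verts H" for u v r s
    using that inj by (auto simp: doubleton_eq_iff inj_on_eq_iff)
  have adj': "{u, v} \<in> edges H \<longleftrightarrow> {p u, p v} \<in> edges (insert_edge {p x, p y} K)"
    if "u \<in> verts H" "v \<in> verts H" for u v
    using adj[OF that] pair[OF that xy(2,3)] d xy(1) by auto
  show ?thesis
  proof (rule that[of "p x" "p y"])
    show "p x \<in> verts K" "p y \<in> verts K" "p x \<noteq> p y"
      using xy im inj by (auto simp: inj_on_eq_iff)
    show "H \<simeq> insert_edge {p x, p y} K"
      unfolding isomorphic_def using p adj' by (intro exI[of _ p]) simp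
    fix e assume e: "e \<in> edges H" "e \<noteq> d"
    obtain r s where rs: "e = {r, s}" "r \<in> verts H" "s \<in> verts H"
      using ends[OF e(1)] by blast
    have "{p r, p s} \<in> edges K" using adj[OF rs(2,3)] e rs(1) by simp
    moreover have "{u, v} \<in> edges (delete_edge H e) \<longleftrightarrow>
        {p u, p v} \<in> edges (delete_edge (insert_edge {p x, p y} K) {p r, p s})"
      if "u \<in> verts H" "v \<in> verts H" for u v
      using adj'[OF that] pair[OF that rs(2,3)] rs(1) by simp
    then have "delete_edge H e \<simeq> delete_edge (insert_edge {p x, p y} K) {p r, p s}"
      unfolding isomorphic_def using p by (intro exI[of _ p]) simp
    ultimately show "\<exists>e'\<in>edges K. delete_edge H e \<simeq> delete_edge (insert_edge {p x, p y} K) e'"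
      by blast
  qed
qed

text \<open>Card \<open>a\<close> fixes \<open>H\<close> up to one added edge, card \<open>c\<close>
  forces that edge to join the two paths, and card \<open>b\<close> then makes \<open>H\<close> a
  path. The indices \<open>b\<close> and \<open>c\<close> may coincide.\<close>

lemma reconstructs_path_graph:
  assumes "a \<in> A" "b \<in> A" "c \<in> A" "A \<subseteq> {0<..<n}"
    and c: "c \<noteq> a" "c \<noteq> n - a"
    and b: "b \<noteq> a" "max a (n - a) < min b (n - b) + 2"
  shows "reconstructs (path_graph n) (path_edge ` A)"
  unfolding reconstructs_def
proof (intro allI impI)
  fix H :: "nat graph"
  assume H: "simple_graph H" and "\<exists>f. inj_on f (path_edge ` A) \<and> f ` path_edge ` A \<subseteq> edges H \<and>
    (\<forall>e\<in>path_edge ` A. delete_edge H (f e) \<simeq> delete_edge (path_graph n) e)"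
  then obtain f where f: "inj_on f (path_edge ` A)" "f ` path_edge ` A \<subseteq> edges H"
    and card: "\<forall>e\<in>path_edge ` A. delete_edge H (f e) \<simeq> delete_edge (path_graph n) e"
    by (elim exE conjE) (rule that)
  define g where "g = f \<circ> path_edge"
  have A: "0 < i" "i < n" if "i \<in> A" for i using that assms(4) by auto
  have g: "g i \<in> edges H" "delete_edge H (g i) \<simeq> split_path n i" if "i \<in> A" for i
    using f(2) card that by (auto simp: g_def delete_edge_path_graph[OF A(1)])
  have g_neq: "g i \<noteq> g a" if "i \<in> A" "i \<noteq> a" for i
    using that assms(1) inj_on_eq_iff[OF f(1), of "path_edge i" "path_edge a"] path_edge_eq_iff[OF A(1) A(1)]
    by (simp add: g_def)
  obtain u' v' where "u' < n" "v' < n" "u' \<noteq> v'" and iso': "H \<simeq> insert_edge {u', v'} (split_path n a)"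
    and del': "\<And>e. e \<in> edges H \<Longrightarrow> e \<noteq> g a \<Longrightarrow> \<exists>e'\<in>edges (split_path n a).
      delete_edge H e \<simeq> delete_edge (insert_edge {u', v'} (split_path n a)) e'"
    using transport_insert_edge[OF H g[OF assms(1)]] by (metis lessThan_iff verts_simps(2))
  define u v where "u = min u' v'" and "v = max u' v'"
  have uv: "u < v" "v < n" and eq: "{u', v'} = {u, v}"
    using \<open>u' < n\<close> \<open>v' < n\<close> \<open>u' \<noteq> v'\<close> by (auto simp: u_def v_def min_def max_def)
  let ?H = "insert_edge {u, v} (split_path n a)"
  have del: "\<exists>e\<in>edges (split_path n a). delete_edge ?H e \<simeq> split_path n i"
    if "i \<in> A" "i \<noteq> a" for i
    using del'[OF g(1)[OF that(1)] g_neq[OF that]] g(2)[OF that(1)] isomorphic_sym isomorphic_trans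
    unfolding eq by blast
  obtain e where "delete_edge ?H e \<simeq> split_path n c"
    using del[OF assms(3) c(1)] by blast
  then have "\<not> (u < a \<longleftrightarrow> v < a)"
    using not_connecting_card[of u v n a e c] A assms(1,3) c by blast
  then have "u < a" "a \<le> v" using uv(1) by auto
  obtain e where "e \<in> edges (split_path n a)" "delete_edge ?H e \<simeq> split_path n b"
    using del[OF assms(2) b(1)] by blast
  then have "?H \<simeq> path_graph n"
    using connecting_card[of u v n a e b] A assms(1,2) b(2) \<open>u < a\<close> \<open>a \<le> v\<close> uv(2) by auto
  then show "H \<simeq> path_graph n" using iso' unfolding eq by (rule isomorphic_trans[rotated])
qed

lemma path_edge_image_card:
  "A \<subseteq> {0<..<n} \<Longrightarrow> card (path_edge ` A) = card A"
  by (intro card_image inj_onI) (metis greaterThanLessThan_iff path_edge_eq_iff subsetD)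

section \<open>Lower bounds: graphs sharing cards with the path\<close>

text \<open>The inclusion \<open>S \<subseteq> {e, e'}\<close> treats sets of at most two cards at
  once, and \<open>e = e'\<close> is allowed.\<close>

lemma not_reconstructsI:
  assumes "simple_graph H" "\<not> H \<simeq> G" "S \<subseteq> {e, e'}"
    and d: "d \<in> edges H" "d' \<in> edges H" "d \<noteq> d'"
    and iso: "delete_edge H d \<simeq> delete_edge G e" "delete_edge H d' \<simeq> delete_edge G e'"
  shows "\<not> reconstructs G S"
proof
  assume "reconstructs G S"
  let ?f = "\<lambda>x. if x = e then d else d'"
  have "inj_on ?f S" "?f ` S \<subseteq> edges H" "\<And>x. x \<in> S \<Longrightarrow> delete_edge H (?f x) \<simeq> delete_edge G x"
    using assms(3) d iso by (auto simp: inj_on_def)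
  with reconstructs_any_type[OF \<open>reconstructs G S\<close> assms(1)] assms(2) show False by blast
qed

text \<open>The counterexample is \<open>P\<^sub>a \<union> C\<^sub>n\<^sub>-\<^sub>a\<close>.\<close>

lemma not_reconstructs_cycle:
  assumes n: "0 < a" "a + 3 \<le> n" and S: "S \<subseteq> {path_edge a, path_edge (n - a)}"
  shows "\<not> reconstructs (path_graph n) S"
proof -
  \<comment> \<open>The new edge closes the right-hand path, which has at least three vertices, into
    a cycle.\<close>
  let ?H = "insert_edge {a, n - 1} (split_path n a)"
  have "\<not> ?H \<simeq> path_graph n"
  proof
    assume "?H \<simeq> path_graph n"
    moreover have "union_of_components ?H {..<a}"
      using n by (auto simp: union_of_components_def doubleton_eq_iff)
    ultimately show False
      using card_union_of_components_isomorphic[of ?H n 0 "{..<a}"] n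
      by (simp add: path_graph_eq_split_path)
  qed
  moreover have "delete_edge ?H {a, n - 1} \<simeq> delete_edge (path_graph n) (path_edge a)"
  proof -
    have "delete_edge ?H {a, n - 1} = split_path n a"
      using n by (intro prod_eqI) auto
    then show ?thesis using n by (simp add: delete_edge_path_graph isomorphic_refl)
  qed
  moreover have "delete_edge ?H {n - 2, n - 1} \<simeq> delete_edge (path_graph n) (path_edge (n - a))"
  proof -
    \<comment> \<open>Rotates the cycle: the opened cycle runs \<open>n - 1\<close>,
      \<open>a\<close>, \<open>a + 1\<close>, up to \<open>n - 2\<close>.\<close>
    define p where "p i = (if i < a then i else if Suc i = n then a else Suc i)" for i
    have "delete_edge ?H {n - 2, n - 1} \<simeq> split_path n a"
    proof (rule isomorphic_lessThanI[where n = n and p = p])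
      show "i = j" if "i < n" "j < n" "p i = p j" for i j
        using that n unfolding p_def by (auto split: if_splits)
      show "p i < n" if "i < n" for i
        using that n unfolding p_def by auto
      show "{i, j} \<in> edges (delete_edge ?H {n - 2, n - 1}) \<longleftrightarrow> {p i, p j} \<in> edges (split_path n a)"
        if "i \<le> j" "j < n" for i j
        using that n
        by (cases "i < a"; cases "Suc i = n"; cases "j < a"; cases "Suc j = n";
            auto simp: p_def doubleton_eq_iff)
    qed simp_all
    then have "delete_edge ?H {n - 2, n - 1} \<simeq> split_path n (n - a)"
      by (rule isomorphic_trans[OF _ split_path_reflect]) (use n in auto)
    then show ?thesis using n by (simp add: delete_edge_path_graph)
  qed
  moreover have "simple_graph ?H" using n by (intro simple_graph_insert_split_path) auto
  moreover have "{a, n - 1} \<noteq> {n - 2, n - 1}" using n by (auto simp: doubleton_eq_iff)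
  moreover have "{a, n - 1} \<in> edges ?H" "{n - 2, n - 1} \<in> edges ?H" using n by auto
  ultimately show ?thesis
    by - (rule not_reconstructsI[OF _ _ S, of ?H _ "{a, n - 1}" "{n - 2, n - 1}"])
qed

text \<open>The counterexample is the spider with legs of lengths \<open>a\<close>, \<open>c\<close> and \<open>n - 1 - a - c\<close>.\<close>

lemma not_reconstructs_spider:
  assumes n: "0 < a" "0 < c" "a + c + 2 \<le> n"
    and x: "x = a \<or> x = n - a" and y: "y = c \<or> y = n - c"
  shows "\<not> reconstructs (path_graph n) {path_edge x, path_edge y}"
proof -
  \<comment> \<open>The centre is \<open>a + c\<close>; the legs are \<open>{..<a}\<close>,
    \<open>{a..<a + c}\<close> and the vertices beyond the centre, of which there is at least
    one.\<close>
  let ?H = "insert_edge {a - 1, a + c} (split_path n a)"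
  let ?e = "{a + c - 1, a + c}"
  have card: "K \<simeq> delete_edge (path_graph n) (path_edge z)"
    if "K \<simeq> split_path n b" "0 < b" "b < n" "z = b \<or> z = n - b" for K :: "nat graph" and b z
    using that split_path_reflect isomorphic_trans delete_edge_path_graph
    by (metis zero_less_diff)
  have "\<not> ?H \<simeq> path_graph n"
  proof
    assume "?H \<simeq> path_graph n"
    then show False
      using split_path_degree_le_2[of ?H n 0 "a + c" "a - 1" "a + c - 1" "a + c + 1"] n
      by (simp add: path_graph_eq_split_path doubleton_eq_iff; arith)
  qed
  moreover have "delete_edge ?H {a - 1, a + c} \<simeq> delete_edge (path_graph n) (path_edge x)"
  proof (rule card[OF _ _ _ x])
    have "delete_edge ?H {a - 1, a + c} = split_path n a"
      using n by (intro prod_eqI) auto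
    then show "delete_edge ?H {a - 1, a + c} \<simeq> split_path n a" by (simp add: isomorphic_refl)
  qed (use n in auto)
  moreover have "delete_edge ?H ?e \<simeq> delete_edge (path_graph n) (path_edge y)"
  proof (rule card[OF _ _ _ y])
    \<comment> \<open>Swaps the first two legs: the detached one comes first, and the other then
      ends at \<open>a + c - 1\<close>, next to the centre.\<close>
    define p where "p i = (if i < a then i + c else if i < a + c then i - a else i)" for i
    show "delete_edge ?H ?e \<simeq> split_path n c"
    proof (rule isomorphic_lessThanI[where n = n and p = p])
      show "i = j" if "i < n" "j < n" "p i = p j" for i j
        using that n unfolding p_def by (auto split: if_splits)
      show "p i < n" if "i < n" for i
        using that n unfolding p_def by auto
      show "{i, j} \<in> edges (delete_edge ?H ?e) \<longleftrightarrow> {p i, p j} \<in> edges (split_path n c)"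
        if "i \<le> j" "j < n" for i j
        using that n
        by (cases "i < a"; cases "i < a + c"; cases "j < a"; cases "j < a + c";
            simp add: p_def doubleton_eq_iff; linarith)
    qed simp_all
  qed (use n in auto)
  moreover have "simple_graph ?H" using n by (intro simple_graph_insert_split_path) auto
  moreover have "{a - 1, a + c} \<noteq> ?e" using n by (auto simp: doubleton_eq_iff)
  moreover have "{a - 1, a + c} \<in> edges ?H" "?e \<in> edges ?H" using n by auto
  ultimately show ?thesis
    by - (rule not_reconstructsI[OF _ _ subset_refl, of ?H _ "{a - 1, a + c}" ?e])
qed

text \<open>Since \<open>n \<ge> 5\<close>, one of \<open>a\<close> and \<open>n - a\<close> is at
  least 3 and can be the length of the cycle.\<close>

lemma not_reconstructs_same_card:
  assumes n: "5 \<le> n" "0 < a" "a < n" and S: "S \<subseteq> {path_edge a, path_edge (n - a)}"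
  shows "\<not> reconstructs (path_graph n) S"
proof (cases "a + 3 \<le> n")
  case True
  then show ?thesis using not_reconstructs_cycle n S by blast
next
  case False
  then show ?thesis using not_reconstructs_cycle[of "n - a" n S] n S by (simp add: insert_commute)
qed

lemma ern_lower:
  assumes n: "5 \<le> n" and S: "S \<subseteq> edges (path_graph n)" "reconstructs (path_graph n) S"
  shows "2 \<le> card S" "odd n \<Longrightarrow> 3 \<le> card S"
proof -
  obtain A where A: "A \<subseteq> {0<..<n}" "S = path_edge ` A"
    using S(1) unfolding edges_path_graph by (auto simp: subset_image_iff)
  have fin: "finite A" using A(1) finite_subset by blast
  have card: "card S = card A" using A path_edge_image_card by blast
  have same: "\<not> A \<subseteq> {a, n - a}" if "0 < a" "a < n" for a
    using not_reconstructs_same_card[OF n that, of S] S(2) A(2) by blast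
  show ge: "2 \<le> card S"
  proof (rule ccontr)
    assume "\<not> 2 \<le> card S"
    then have "card A \<le> Suc 0" using card by simp
    then have "\<forall>a\<in>A. \<forall>b\<in>A. a = b" using fin by (simp add: card_le_Suc0_iff_eq)
    moreover obtain a where "a \<in> A" using same[of 1] n by auto
    ultimately have "A \<subseteq> {a, n - a}" by blast
    then show False using same[of a] A(1) \<open>a \<in> A\<close> by auto
  qed
  assume "odd n"
  show "3 \<le> card S"
  proof (rule ccontr)
    assume "\<not> 3 \<le> card S"
    then have "card A = 2" using ge card by simp
    then obtain x y where xy: "A = {x, y}" "x \<noteq> y" by (auto simp: card_2_iff)
    have lt: "0 < x" "x < n" "0 < y" "y < n" using A(1) xy(1) by auto
    have "y \<noteq> n - x" using same[OF lt(1,2)] xy(1) by auto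
    \<comment> \<open>The smaller component orders are distinct and at most \<open>b\<close>, so
      their sum is at most \<open>2 * b - 1 = n - 2\<close>, as the spider requires.\<close>
    then have "min x (n - x) \<noteq> min y (n - y)"
      using xy(2) lt by (auto simp: min_def split: if_splits)
    moreover obtain b where b: "n = 2 * b + 1" using \<open>odd n\<close> by (rule oddE)
    then have "min x (n - x) \<le> b" "min y (n - y) \<le> b" by auto
    ultimately have "min x (n - x) + min y (n - y) + 2 \<le> n" using b by linarith
    then have "\<not> reconstructs (path_graph n) {path_edge x, path_edge y}"
      using lt by (intro not_reconstructs_spider[of "min x (n - x)" "min y (n - y)"]) (auto simp: min_def)
    then show False using S(2) A(2) xy(1) by simp
  qed
qed

theorem theorem4p1:
  fixes n :: nat
  assumes "n \<ge> 5"
  shows "(even n \<longrightarrow> ern (path_graph n) = 2) \<and> (odd n \<longrightarrow> ern (path_graph n) = 3)"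
proof -
  have witness: "\<exists>S. S \<subseteq> edges (path_graph n) \<and> finite S \<and> card S = card A \<and>
      reconstructs (path_graph n) S"
    if "A \<subseteq> {0<..<n}" "reconstructs (path_graph n) (path_edge ` A)" for A
    using that path_edge_image_card[OF that(1)] finite_subset[OF that(1)]
    by (intro exI[of _ "path_edge ` A"]) (auto simp: edges_path_graph)
  have "ern (path_graph n) = enat 2" if even: "even n"
  proof -
    obtain m where m: "n = 2 * m" using even by (rule evenE)
    then have "m \<ge> 3" using assms by simp
    \<comment> \<open>The card \<open>m - 1\<close> is unlike \<open>m\<close> and nearly balanced,
      so it serves as both \<open>b\<close> and \<open>c\<close>.\<close>
    have "reconstructs (path_graph n) (path_edge ` {m, m - 1})"
      by (rule reconstructs_path_graph[of m _ "m - 1" "m - 1"]) (use m \<open>m \<ge> 3\<close> in auto)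
    moreover have "card {m, m - 1} = 2" using \<open>m \<ge> 3\<close> by auto
    moreover have "{m, m - 1} \<subseteq> {0<..<n}" using m \<open>m \<ge> 3\<close> by auto
    ultimately show ?thesis
      unfolding ern_eq_enat_iff using witness ern_lower(1)[OF assms] by metis
  qed
  moreover have "ern (path_graph n) = enat 3" if odd: "odd n"
  proof -
    obtain m where m: "n = 2 * m + 1" using odd by (rule oddE)
    then have "m \<ge> 2" using assms by simp
    \<comment> \<open>Here \<open>m + 1 = n - m\<close> gives the same card as \<open>m\<close> and
      serves only as \<open>b\<close>, while \<open>m - 1\<close> misses the bound on
      \<open>b\<close> by one and serves as \<open>c\<close>.\<close>
    have "reconstructs (path_graph n) (path_edge ` {m, m + 1, m - 1})"
      by (rule reconstructs_path_graph[of m _ "m + 1" "m - 1"]) (use m \<open>m \<ge> 2\<close> in auto)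
    moreover have "card {m, m + 1, m - 1} = 3" using \<open>m \<ge> 2\<close> by auto
    moreover have "{m, m + 1, m - 1} \<subseteq> {0<..<n}" using m \<open>m \<ge> 2\<close> by auto
    ultimately show ?thesis
      unfolding ern_eq_enat_iff using witness ern_lower(2)[OF assms _ _ odd] by metis
  qed
  ultimately show ?thesis by (simp add: numeral_eq_enat)
qed

end
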